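(* Let $k,d\ge 1$, let $\xi=(\mu,\nu)=(\mu_1,\dots,\mu_k,\nu)\in\mathcal{P}(\mathbb{R}^d)^k\times\mathcal{QAHP}(\mathbb{R}^d)$ and let $q\in\mathbb{R}^k$. For every set $E\subseteq\mathbb{R}^d$ there exist unique values $\dim_\xi^q(E)$, $\Delta_\xi^q(E)$ and $\mathrm{Dim}_\xi^q(E)$ in $[-\infty,+\infty]$ such that, for $t\in\mathbb{R}$: (1) $\mathcal{H}_\xi^{q,t}(E)=\infty$ for $t<\dim_\xi^q(E)$ and $\mathcal{H}_\xi^{q,t}(E)=0$ for $t>\dim_\xi^q(E)$; (2) $\overline{\mathcal{P}}_\xi^{q,t}(E)=\infty$ for $t<\Delta_\xi^q(E)$ and $\overline{\mathcal{P}}_\xi^{q,t}(E)=0$ for $t>\Delta_\xi^q(E)$; (3) $\mathcal{P}_\xi^{q,t}(E)=\infty$ for $t<\mathrm{Dim}_\xi^q(E)$ and $\mathcal{P}_\xi^{q,t}(E)=0$ for $t>\mathrm{Dim}_\xi^q(E)$.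
   Context: $\mathcal{P}(\mathbb{R}^d)$ is the set of Borel probability measures on $\mathbb{R}^d$. $|U|$ denotes the diameter of $U$. $\mathcal{QAHP}(\mathbb{R}^d)$ (quasi-Ahlfors probability measures) is the set of $\nu\in\mathcal{P}(\mathbb{R}^d)$ for which there is $\alpha>0$ with $\limsup_{|U|\to0}\nu(U)/|U|^\alpha<+\infty$. $B(x,r)$ is the closed ball of centre $x$ and radius $r>0$. For $\mu=(\mu_1,\dots,\mu_k)$ and $q\in\mathbb{R}^k$, $\mu(B(x,r))^q=\prod_{j=1}^k\mu_j(B(x,r))^{q_j}$. Conventions: $0^s=+\infty$ for $s<0$, $0^0=1$, $0^s=0$ for $s>0$, $0\cdot\infty=0$. A centred $\varepsilon$-covering of $E$ is a finite or countable family of balls $B(x_i,r_i)$ with $x_i\in E$, diameter less than $\varepsilon$, and $E\subseteq\bigcup_iB(x_i,r_i)$. A centred $\varepsilon$-packing of $E$ is a finite or countable family of pairwise disjoint balls $B(x_i,r_i)$ with $x_i\in E$ and diameter less than $\varepsilon$. For $\xi=(\mu,\nu)$, $(q,t)\in\mathbb{R}^k\times\mathbb{R}$ and $E\subseteq\mathbb{R}^d$: $\overline{\mathcal{H}}_{\xi,\varepsilon}^{q,t}(E)=\inf\sum_i\mu(B(x_i,r_i))^q\nu(B(x_i,r_i))^t$ over all centred $\varepsilon$-coverings of $E$, $\overline{\mathcal{H}}_\xi^{q,t}(E)=\lim_{\varepsilon\downarrow0}\overline{\mathcal{H}}_{\xi,\varepsilon}^{q,t}(E)$, $\mathcal{H}_\xi^{q,t}(E)=\sup_{F\subseteq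 E}\overline{\mathcal{H}}_\xi^{q,t}(F)$; $\overline{\mathcal{P}}_{\xi,\varepsilon}^{q,t}(E)=\sup\sum_i\mu(B(x_i,r_i))^q\nu(B(x_i,r_i))^t$ over all centred $\varepsilon$-packings of $E$, $\overline{\mathcal{P}}_\xi^{q,t}(E)=\lim_{\varepsilon\downarrow0}\overline{\mathcal{P}}_{\xi,\varepsilon}^{q,t}(E)$, $\mathcal{P}_\xi^{q,t}(E)=\inf\{\sum_i\overline{\mathcal{P}}_\xi^{q,t}(E_i): E\subseteq\bigcup_iE_i\}$ over countable covers. *)

theory Defs
  imports "HOL-Probability.Probability"
begin

definition borel_prob :: "(real^'d) measure set" where
  "borel_prob = {\<nu>. prob_space \<nu> \<and> sets \<nu> = sets borel}"

text \<open>
  The limit superior is along bounded Borel sets whose diameter tends to 0 through positive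
  values. Boundedness is required explicitly because \<^const>\<open>diameter\<close> has an unspecified real
  value on unbounded sets, whose diameter is meant to be infinite.
\<close>

definition quasi_ahlfors_prob :: "(real^'d) measure set" where
  "quasi_ahlfors_prob = {\<nu> \<in> borel_prob. \<exists>\<alpha>>0.
     Limsup (inf (filtercomap diameter (at_right 0)) (principal {U \<in> sets borel. bounded U}))
       (\<lambda>U. ereal (measure \<nu> U / diameter U powr \<alpha>)) < \<infinity>}"

text \<open>
  Real powers of a nonnegative number, with values in \<open>[0, \<infinity>]\<close>; unlike \<^term>\<open>0 powr s\<close>,
  the power of 0 is infinite for negative exponents and 1 for exponent 0. The convention
  \<open>0 * \<infinity> = 0\<close> is that of the type \<^typ>\<open>ennreal\<close>.
\<close>

definition epow :: "real \<Rightarrow> real \<Rightarrow> ennreal" where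
  "epow x s = (if x = 0 then (if s < 0 then \<infinity> else if s = 0 then 1 else 0)
               else ennreal (x powr s))"

definition ball_weight ::
  "('k::finite \<Rightarrow> (real^'d) measure) \<Rightarrow> (real^'d) measure \<Rightarrow> real^'k \<Rightarrow> real
     \<Rightarrow> real^'d \<Rightarrow> real \<Rightarrow> ennreal" where
  "ball_weight \<mu> \<nu> q t x r =
     (\<Prod>j\<in>UNIV. epow (measure (\<mu> j) (cball x r)) (q $ j)) * epow (measure \<nu> (cball x r)) t"

text \<open>
  Finite or countable families of balls are indexed by an arbitrary set \<open>I\<close> of natural numbers;
  the empty family is allowed.
\<close>

definition centred_balls ::
  "real \<Rightarrow> (real^'d) set \<Rightarrow> nat set \<Rightarrow> (nat \<Rightarrow> real^'d) \<Rightarrow> (nat \<Rightarrow> real) \<Rightarrow> bool" where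
  "centred_balls \<epsilon> E I x r \<longleftrightarrow>
     (\<forall>i\<in>I. x i \<in> E \<and> 0 < r i \<and> diameter (cball (x i) (r i)) < \<epsilon>)"

definition centred_covering ::
  "real \<Rightarrow> (real^'d) set \<Rightarrow> nat set \<Rightarrow> (nat \<Rightarrow> real^'d) \<Rightarrow> (nat \<Rightarrow> real) \<Rightarrow> bool" where
  "centred_covering \<epsilon> E I x r \<longleftrightarrow>
     centred_balls \<epsilon> E I x r \<and> E \<subseteq> (\<Union>i\<in>I. cball (x i) (r i))"

definition centred_packing ::
  "real \<Rightarrow> (real^'d) set \<Rightarrow> nat set \<Rightarrow> (nat \<Rightarrow> real^'d) \<Rightarrow> (nat \<Rightarrow> real) \<Rightarrow> bool" where
  "centred_packing \<epsilon> E I x r \<longleftrightarrow>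
     centred_balls \<epsilon> E I x r \<and> disjoint_family_on (\<lambda>i. cball (x i) (r i)) I"

definition Hbar_eps ::
  "('k::finite \<Rightarrow> (real^'d) measure) \<Rightarrow> (real^'d) measure \<Rightarrow> real^'k \<Rightarrow> real
     \<Rightarrow> real \<Rightarrow> (real^'d) set \<Rightarrow> ennreal" where
  "Hbar_eps \<mu> \<nu> q t \<epsilon> E =
     Inf {(\<Sum>\<^sub>\<infinity>i\<in>I. ball_weight \<mu> \<nu> q t (x i) (r i)) | I x r. centred_covering \<epsilon> E I x r}"

definition Hbar ::
  "('k::finite \<Rightarrow> (real^'d) measure) \<Rightarrow> (real^'d) measure \<Rightarrow> real^'k \<Rightarrow> real
     \<Rightarrow> (real^'d) set \<Rightarrow> ennreal" where
  "Hbar \<mu> \<nu> q t E = Lim (at_right 0) (\<lambda>\<epsilon>. Hbar_eps \<mu> \<nu> q t \<epsilon> E)"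

definition Hmeas ::
  "('k::finite \<Rightarrow> (real^'d) measure) \<Rightarrow> (real^'d) measure \<Rightarrow> real^'k \<Rightarrow> real
     \<Rightarrow> (real^'d) set \<Rightarrow> ennreal" where
  "Hmeas \<mu> \<nu> q t E = (SUP F\<in>Pow E. Hbar \<mu> \<nu> q t F)"

definition Pbar_eps ::
  "('k::finite \<Rightarrow> (real^'d) measure) \<Rightarrow> (real^'d) measure \<Rightarrow> real^'k \<Rightarrow> real
     \<Rightarrow> real \<Rightarrow> (real^'d) set \<Rightarrow> ennreal" where
  "Pbar_eps \<mu> \<nu> q t \<epsilon> E =
     Sup {(\<Sum>\<^sub>\<infinity>i\<in>I. ball_weight \<mu> \<nu> q t (x i) (r i)) | I x r. centred_packing \<epsilon> E I x r}"

definition Pbar ::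
  "('k::finite \<Rightarrow> (real^'d) measure) \<Rightarrow> (real^'d) measure \<Rightarrow> real^'k \<Rightarrow> real
     \<Rightarrow> (real^'d) set \<Rightarrow> ennreal" where
  "Pbar \<mu> \<nu> q t E = Lim (at_right 0) (\<lambda>\<epsilon>. Pbar_eps \<mu> \<nu> q t \<epsilon> E)"

definition Pmeas ::
  "('k::finite \<Rightarrow> (real^'d) measure) \<Rightarrow> (real^'d) measure \<Rightarrow> real^'k \<Rightarrow> real
     \<Rightarrow> (real^'d) set \<Rightarrow> ennreal" where
  "Pmeas \<mu> \<nu> q t E =
     Inf {(\<Sum>\<^sub>\<infinity>i\<in>I. Pbar \<mu> \<nu> q t (S i)) | (I :: nat set) S. E \<subseteq> (\<Union>i\<in>I. S i)}"

text \<open>The limits defining \<^const>\<open>Hbar\<close> and \<^const>\<open>Pbar\<close> exist, by monotonicity.\<close>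

lemma centred_balls_mono: "centred_balls \<epsilon> E I x r \<Longrightarrow> \<epsilon> \<le> \<delta> \<Longrightarrow> centred_balls \<delta> E I x r"
  unfolding centred_balls_def by (meson less_le_trans)

lemma Hbar_eps_antimono:
  assumes "\<epsilon> \<le> \<delta>"
  shows "Hbar_eps \<mu> \<nu> q t \<delta> E \<le> Hbar_eps \<mu> \<nu> q t \<epsilon> E"
  unfolding Hbar_eps_def centred_covering_def
  by (rule Inf_superset_mono, rule Collect_mono, rule impI, elim exE conjE, intro exI conjI)
     (assumption | erule centred_balls_mono, rule assms)+

lemma Pbar_eps_mono:
  assumes "\<epsilon> \<le> \<delta>"
  shows "Pbar_eps \<mu> \<nu> q t \<epsilon> E \<le> Pbar_eps \<mu> \<nu> q t \<delta> E"
  unfolding Pbar_eps_def centred_packing_def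
  by (rule Sup_subset_mono, rule Collect_mono, rule impI, elim exE conjE, intro exI conjI)
     (assumption | erule centred_balls_mono, rule assms)+

lemma tendsto_SUP_at_right_0:
  fixes f :: "real \<Rightarrow> ennreal"
  assumes "\<And>x y. x \<le> y \<Longrightarrow> f y \<le> f x"
  shows "(f \<longlongrightarrow> (SUP x\<in>{0<..}. f x)) (at_right 0)"
proof (rule order_tendstoI)
  fix a assume "a < (SUP x\<in>{0<..}. f x)"
  then obtain y where y: "y > 0" "a < f y"
    by (auto simp: less_SUP_iff)
  have "a < f x" if "x < y" for x
    using y(2) assms[of x y] that by simp
  with y(1) show "\<forall>\<^sub>F x in at_right 0. a < f x"
    unfolding eventually_at_right_field by blast
next
  fix a assume a: "(SUP x\<in>{0<..}. f x) < a"
  have "f x < a" if "x > 0" for x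
    using a SUP_upper[of x "{0<..}" f] that by simp
  then show "\<forall>\<^sub>F x in at_right 0. f x < a"
    unfolding eventually_at_right_field by (intro exI[of _ 1]) simp
qed

lemma tendsto_INF_at_right_0:
  fixes f :: "real \<Rightarrow> ennreal"
  assumes "\<And>x y. x \<le> y \<Longrightarrow> f x \<le> f y"
  shows "(f \<longlongrightarrow> (INF x\<in>{0<..}. f x)) (at_right 0)"
proof (rule order_tendstoI)
  fix a assume "(INF x\<in>{0<..}. f x) < a"
  then obtain y where y: "y > 0" "f y < a"
    by (auto simp: INF_less_iff)
  have "f x < a" if "x < y" for x
    using y(2) assms[of x y] that by simp
  with y(1) show "\<forall>\<^sub>F x in at_right 0. f x < a"
    unfolding eventually_at_right_field by blast
next
  fix a assume a: "a < (INF x\<in>{0<..}. f x)"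
  have "a < f x" if "x > 0" for x
    using a INF_lower[of x "{0<..}" f] that by simp
  then show "\<forall>\<^sub>F x in at_right 0. a < f x"
    unfolding eventually_at_right_field by (intro exI[of _ 1]) simp
qed

lemma tendsto_Hbar: "((\<lambda>\<epsilon>. Hbar_eps \<mu> \<nu> q t \<epsilon> E) \<longlongrightarrow> Hbar \<mu> \<nu> q t E) (at_right 0)"
proof -
  have lim: "((\<lambda>\<epsilon>. Hbar_eps \<mu> \<nu> q t \<epsilon> E) \<longlongrightarrow> (SUP \<epsilon>\<in>{0<..}. Hbar_eps \<mu> \<nu> q t \<epsilon> E)) (at_right 0)"
    by (intro tendsto_SUP_at_right_0 Hbar_eps_antimono)
  have "Hbar \<mu> \<nu> q t E = (SUP \<epsilon>\<in>{0<..}. Hbar_eps \<mu> \<nu> q t \<epsilon> E)"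
    unfolding Hbar_def by (rule tendsto_Lim[OF trivial_limit_at_right_real lim])
  with lim show ?thesis
    by simp
qed

lemma tendsto_Pbar: "((\<lambda>\<epsilon>. Pbar_eps \<mu> \<nu> q t \<epsilon> E) \<longlongrightarrow> Pbar \<mu> \<nu> q t E) (at_right 0)"
proof -
  have lim: "((\<lambda>\<epsilon>. Pbar_eps \<mu> \<nu> q t \<epsilon> E) \<longlongrightarrow> (INF \<epsilon>\<in>{0<..}. Pbar_eps \<mu> \<nu> q t \<epsilon> E)) (at_right 0)"
    by (intro tendsto_INF_at_right_0 Pbar_eps_mono)
  have "Pbar \<mu> \<nu> q t E = (INF \<epsilon>\<in>{0<..}. Pbar_eps \<mu> \<nu> q t \<epsilon> E)"
    unfolding Pbar_def by (rule tendsto_Lim[OF trivial_limit_at_right_real lim])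
  with lim show ?thesis
    by simp
qed

end

theory Submission
  imports Defs
begin

text \<open>
  The three assertions have one cause. Since \<open>\<nu>\<close> is quasi-Ahlfors, \<open>\<nu>(B(x,r))\<close> is at most a
  constant times \<open>r\<^sup>\<alpha>\<close> for small balls, and therefore tends to 0 with the radius, uniformly in
  the centre. Raising the exponent of \<open>\<nu>(B(x,r))\<close> from \<open>s\<close> to \<open>t > s\<close> multiplies the weight
  of a ball by \<open>\<nu>(B(x,r))\<close> to the positive power \<open>t - s\<close>, so for every constant \<open>c\<close> the weight
  at \<open>s\<close> is at least \<open>c\<close> times the weight at \<open>t\<close> on all sufficiently small balls
  (\<open>ball_weight_amplified\<close>).

  Only small balls matter in the limits that define \<^const>\<open>Hbar\<close> and \<^const>\<open>Pbar\<close>, so this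
  inequality passes to sums over coverings and packings, then to these limits, and from there
  to \<^const>\<open>Hmeas\<close> and \<^const>\<open>Pmeas\<close>. Each of the resulting functions \<open>\<Phi>\<close> of the exponent
  satisfies \<open>c * \<Phi> t \<le> \<Phi> s\<close> for \<open>s < t\<close> and \<^emph>\<open>every\<close> finite \<open>c\<close>. Hence \<open>\<Phi> s < \<infinity>\<close> forces
  \<open>\<Phi> t = 0\<close>: the function jumps from \<open>\<infinity>\<close> to 0 at a single point of the extended line
  (\<open>critical_exponent\<close>).

  The constant is kept on the side of the larger exponent because \<open>c * \<Phi> t \<le> \<Phi> s\<close> passes
  through infima by monotonicity of multiplication alone.
\<close>

section \<open>Functions with a jump from infinity to zero\<close>

lemma ennreal_zero_or_top_if_multiples_le:
  fixes a b :: ennreal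
  assumes "\<And>c::real. ennreal c * a \<le> b"
  shows "a = 0 \<or> b = \<infinity>"
proof -
  have "\<infinity> * a = (SUP n::nat. of_nat n * a)"
    by (simp add: ennreal_SUP_of_nat_eq_top[symmetric] SUP_mult_right_ennreal)
  also have "\<dots> \<le> b"
    using assms by (intro SUP_least) (metis ennreal_of_nat_eq_real_of_nat)
  finally show ?thesis
    by (auto simp: ennreal_top_mult top_unique split: if_splits)
qed

text \<open>
  The critical value is the supremum of the exponents at which \<open>\<Phi>\<close> is infinite. It is unique
  because the real numbers are dense in the extended line: at a real number strictly between two
  candidates, \<open>\<Phi>\<close> would be both \<open>\<infinity>\<close> and 0.
\<close>

lemma critical_exponent:
  fixes \<Phi> :: "real \<Rightarrow> ennreal"
  assumes amplified: "\<And>s t c. s < t \<Longrightarrow> ennreal c * \<Phi> t \<le> \<Phi> s"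
  shows "\<exists>!d::ereal. \<forall>t::real. (ereal t < d \<longrightarrow> \<Phi> t = \<infinity>) \<and> (d < ereal t \<longrightarrow> \<Phi> t = 0)"
proof -
  have jump: "\<Phi> t = 0 \<or> \<Phi> s = \<infinity>" if "s < t" for s t
    using amplified[OF that] by (rule ennreal_zero_or_top_if_multiples_le)
  define d where "d = (SUP t\<in>{t. \<Phi> t = \<infinity>}. ereal t)"
  have infinite_below: "\<Phi> t = \<infinity>" if t: "ereal t < d" for t
  proof -
    obtain u where "\<Phi> u = \<infinity>" "t < u"
      using t by (auto simp: d_def less_SUP_iff)
    then show ?thesis
      using jump[of t u] by auto
  qed
  have zero_above: "\<Phi> t = 0" if t: "d < ereal t" for t
  proof -
    obtain u where u: "d < ereal u" "u < t"
      using ereal_dense2[OF t] by auto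
    then have "\<Phi> u \<noteq> \<infinity>"
      using SUP_upper[of u "{t. \<Phi> t = \<infinity>}" ereal] by (auto simp: d_def)
    then show ?thesis
      using jump[OF u(2)] by auto
  qed
  have not_less: "\<not> a < b"
    if "\<And>t. a < ereal t \<Longrightarrow> \<Phi> t = 0" "\<And>t. ereal t < b \<Longrightarrow> \<Phi> t = \<infinity>" for a b
    using that ereal_dense2[of a b] by fastforce
  show ?thesis
  proof (rule ex1I[of _ d])
    fix d' assume "\<forall>t. (ereal t < d' \<longrightarrow> \<Phi> t = \<infinity>) \<and> (d' < ereal t \<longrightarrow> \<Phi> t = 0)"
    then show "d' = d"
      using not_less[of d d'] not_less[of d' d] infinite_below zero_above
      by (meson linorder_neqE)
  qed (use infinite_below zero_above in blast)
qed

section \<open>Weights of small balls\<close>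

text \<open>
  A finite limit superior bounds \<open>\<nu>(U)\<close> by a constant times \<open>|U|\<^sup>\<alpha>\<close> for all small \<open>U\<close>. Closed
  balls of positive radius are among these sets, since their diameter is positive.
\<close>

lemma quasi_ahlfors_small_balls:
  fixes \<nu> :: "(real^'a) measure"
  assumes "\<nu> \<in> quasi_ahlfors_prob" and "0 < \<eta>"
  obtains \<delta> where "0 < \<delta>"
    "\<And>x r. 0 < r \<Longrightarrow> diameter (cball x r) < \<delta> \<Longrightarrow> measure \<nu> (cball x r) \<le> \<eta>"
proof -
  let ?F = "inf (filtercomap diameter (at_right 0)) (principal {U \<in> sets borel. bounded U})
    :: (real^'a) set filter"
  obtain \<alpha> where \<alpha>: "\<alpha> > 0"
    and lim: "Limsup ?F (\<lambda>U. ereal (measure \<nu> U / diameter U powr \<alpha>)) < \<infinity>"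
    using assms(1) unfolding quasi_ahlfors_prob_def by blast
  obtain C where C: "Limsup ?F (\<lambda>U. ereal (measure \<nu> U / diameter U powr \<alpha>)) < ereal C"
    using ereal_dense2[OF lim] by blast
  obtain Q b where "b > 0" "\<forall>y>0. y < b \<longrightarrow> Q y"
    and "\<And>U. Q (diameter U) \<Longrightarrow> U \<in> sets borel \<Longrightarrow> bounded U
                 \<Longrightarrow> measure \<nu> U / diameter U powr \<alpha> < C"
    using Limsup_lessD[OF C]
    unfolding eventually_inf_principal eventually_filtercomap eventually_at_right_field
    by auto
  then obtain \<delta>1 where \<delta>1: "\<delta>1 > 0"
    and bound: "\<And>U. bounded U \<Longrightarrow> U \<in> sets borel \<Longrightarrow> 0 < diameter U \<Longrightarrow> diameter U < \<delta>1
                 \<Longrightarrow> measure \<nu> U / diameter U powr \<alpha> < C"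
    by (metis (no_types))
  \<comment> \<open>The maximum makes the bound positive, so that \<open>max C 1 * \<delta>\<^sup>\<alpha> = \<eta>\<close> can be solved for \<open>\<delta>\<close>;
      the second term is the solution.\<close>
  define \<delta> where "\<delta> = min \<delta>1 ((\<eta> / max C 1) powr (1 / \<alpha>))"
  show thesis
  proof (rule that)
    show "0 < \<delta>"
      using \<delta>1 assms(2) by (simp add: \<delta>_def)
  next
    fix x :: "real^'a" and r :: real
    assume r: "0 < r" and small: "diameter (cball x r) < \<delta>"
    let ?D = "diameter (cball x r)"
    have D: "0 < ?D"
      using r by simp
    have "measure \<nu> (cball x r) < C * ?D powr \<alpha>"
      using bound[of "cball x r"] small D by (simp add: \<delta>_def field_simps)
    also have "\<dots> \<le> max C 1 * ?D powr \<alpha>"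
      by (intro mult_right_mono) auto
    also have "\<dots> \<le> max C 1 * ((\<eta> / max C 1) powr (1 / \<alpha>)) powr \<alpha>"
      using small D \<alpha> by (intro mult_left_mono powr_mono2) (auto simp: \<delta>_def)
    also have "\<dots> = \<eta>"
      using \<alpha> assms(2) by (simp add: powr_powr)
    finally show "measure \<nu> (cball x r) \<le> \<eta>"
      by simp
  qed
qed

text \<open>
  For positive \<open>x\<close> this is the law of exponents. For \<open>x = 0\<close> the conventions on powers of 0 make
  the inequality hold for every \<open>c\<close>: if \<open>t > 0\<close> then the left-hand side vanishes, and otherwise
  \<open>s < 0\<close> and the right-hand side is infinite.
\<close>

lemma epow_amplified:
  assumes "s < t" "0 \<le> x" "c * x powr (t - s) \<le> 1"
  shows "ennreal c * epow x t \<le> epow x s"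
proof (cases "x = 0")
  case True
  with assms show ?thesis
    by (auto simp: epow_def)
next
  case False
  have "c * x powr t = (c * x powr (t - s)) * x powr s"
    using powr_add[of x "t - s" s] by simp
  also have "\<dots> \<le> x powr s"
    using mult_right_mono[OF assms(3), of "x powr s"] by simp
  finally show ?thesis
    using False by (simp add: epow_def ennreal_mult''[symmetric] ennreal_leI)
qed

lemma ball_weight_amplified:
  fixes \<nu> :: "(real^'a) measure"
  assumes "\<nu> \<in> quasi_ahlfors_prob" "s < t"
  obtains \<delta> where "0 < \<delta>"
    "\<And>x r. 0 < r \<Longrightarrow> diameter (cball x r) < \<delta> \<Longrightarrow>
       ennreal c * ball_weight \<mu> \<nu> q t x r \<le> ball_weight \<mu> \<nu> q s x r"
proof -
  \<comment> \<open>The solution of \<open>max c 1 * \<eta> powr (t - s) = 1\<close>.\<close>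
  define \<eta> where "\<eta> = (1 / max c 1) powr (1 / (t - s))"
  have "0 < \<eta>"
    by (simp add: \<eta>_def)
  then obtain \<delta> where \<delta>: "0 < \<delta>"
    "\<And>x r. 0 < r \<Longrightarrow> diameter (cball x r) < \<delta> \<Longrightarrow> measure \<nu> (cball x r) \<le> \<eta>"
    using quasi_ahlfors_small_balls[OF assms(1)] by metis
  show thesis
  proof (rule that[OF \<delta>(1)])
    fix x :: "real^'a" and r :: real
    assume "0 < r" "diameter (cball x r) < \<delta>"
    let ?m = "measure \<nu> (cball x r)"
    have "c * ?m powr (t - s) \<le> max c 1 * ?m powr (t - s)"
      by (intro mult_right_mono) auto
    also have "\<dots> \<le> max c 1 * \<eta> powr (t - s)"
      using \<delta>(2) \<open>0 < r\<close> \<open>diameter (cball x r) < \<delta>\<close> assms(2)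
      by (intro mult_left_mono powr_mono2) auto
    also have "\<dots> = 1"
      using assms(2) by (simp add: \<eta>_def powr_powr)
    finally have "ennreal c * epow ?m t \<le> epow ?m s"
      using assms(2) by (intro epow_amplified) auto
    then show "ennreal c * ball_weight \<mu> \<nu> q t x r \<le> ball_weight \<mu> \<nu> q s x r"
      unfolding ball_weight_def
      by (subst mult.left_commute) (rule mult_left_mono, auto)
  qed
qed

section \<open>Passage to sums, limits and measures\<close>

lemma cmult_infsum_le_ennreal:
  fixes f g :: "'a \<Rightarrow> ennreal"
  assumes "\<And>i. i \<in> I \<Longrightarrow> c * f i \<le> g i"
  shows "c * (\<Sum>\<^sub>\<infinity>i\<in>I. f i) \<le> (\<Sum>\<^sub>\<infinity>i\<in>I. g i)"
proof -
  have "c * (\<Sum>\<^sub>\<infinity>i\<in>I. f i) = (SUP F\<in>{F. finite F \<and> F \<subseteq> I}. \<Sum>i\<in>F. c * f i)"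
    by (simp add: nonneg_infsum_complete SUP_mult_left_ennreal sum_distrib_left)
  also have "\<dots> \<le> (SUP F\<in>{F. finite F \<and> F \<subseteq> I}. \<Sum>i\<in>F. g i)"
    by (intro SUP_subset_mono sum_mono assms) auto
  also have "\<dots> = (\<Sum>\<^sub>\<infinity>i\<in>I. g i)"
    by (simp add: nonneg_infsum_complete)
  finally show ?thesis .
qed

lemma centred_sum_amplified:
  assumes "\<And>x r. 0 < r \<Longrightarrow> diameter (cball x r) < \<delta> \<Longrightarrow>
             ennreal c * ball_weight \<mu> \<nu> q t x r \<le> ball_weight \<mu> \<nu> q s x r"
    and "\<epsilon> \<le> \<delta>" and "centred_balls \<epsilon> E I x r"
  shows "ennreal c * (\<Sum>\<^sub>\<infinity>i\<in>I. ball_weight \<mu> \<nu> q t (x i) (r i))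
           \<le> (\<Sum>\<^sub>\<infinity>i\<in>I. ball_weight \<mu> \<nu> q s (x i) (r i))"
  using assms unfolding centred_balls_def
  by (intro cmult_infsum_le_ennreal) (meson less_le_trans)

lemma cmult_limit_le_at_right_0:
  fixes f g :: "real \<Rightarrow> ennreal"
  assumes "0 < \<delta>" "\<And>\<epsilon>. \<epsilon> \<le> \<delta> \<Longrightarrow> ennreal c * f \<epsilon> \<le> g \<epsilon>"
    and "(f \<longlongrightarrow> a) (at_right 0)" "(g \<longlongrightarrow> b) (at_right 0)"
  shows "ennreal c * a \<le> b"
proof (rule tendsto_le[OF trivial_limit_at_right_real assms(4)])
  show "((\<lambda>\<epsilon>. ennreal c * f \<epsilon>) \<longlongrightarrow> ennreal c * a) (at_right 0)"
    using assms(3) by (intro ennreal_tendsto_cmult) auto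
  show "\<forall>\<^sub>F \<epsilon> in at_right 0. ennreal c * f \<epsilon> \<le> g \<epsilon>"
    unfolding eventually_at_right_field using assms(1,2) by (intro exI[of _ \<delta>]) auto
qed

lemma Hbar_amplified:
  assumes "\<nu> \<in> quasi_ahlfors_prob" "s < t"
  shows "ennreal c * Hbar \<mu> \<nu> q t E \<le> Hbar \<mu> \<nu> q s E"
proof -
  obtain \<delta> where \<delta>: "0 < \<delta>" "\<And>x r. 0 < r \<Longrightarrow> diameter (cball x r) < \<delta> \<Longrightarrow>
      ennreal c * ball_weight \<mu> \<nu> q t x r \<le> ball_weight \<mu> \<nu> q s x r"
    using ball_weight_amplified[OF assms] by metis
  have "ennreal c * Hbar_eps \<mu> \<nu> q t \<epsilon> E \<le> Hbar_eps \<mu> \<nu> q s \<epsilon> E" if "\<epsilon> \<le> \<delta>" for \<epsilon>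
    unfolding Hbar_eps_def[of _ _ _ s]
  proof (rule Inf_greatest, clarify)
    fix I x r assume cov: "centred_covering \<epsilon> E I x r"
    then have "Hbar_eps \<mu> \<nu> q t \<epsilon> E \<le> (\<Sum>\<^sub>\<infinity>i\<in>I. ball_weight \<mu> \<nu> q t (x i) (r i))"
      unfolding Hbar_eps_def by (intro Inf_lower) blast
    then have "ennreal c * Hbar_eps \<mu> \<nu> q t \<epsilon> E
        \<le> ennreal c * (\<Sum>\<^sub>\<infinity>i\<in>I. ball_weight \<mu> \<nu> q t (x i) (r i))"
      by (rule mult_left_mono) simp
    also have "\<dots> \<le> (\<Sum>\<^sub>\<infinity>i\<in>I. ball_weight \<mu> \<nu> q s (x i) (r i))"
      using cov that unfolding centred_covering_def
      by (intro centred_sum_amplified[OF \<delta>(2)]) auto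
    finally show "ennreal c * Hbar_eps \<mu> \<nu> q t \<epsilon> E
        \<le> (\<Sum>\<^sub>\<infinity>i\<in>I. ball_weight \<mu> \<nu> q s (x i) (r i))" .
  qed
  then show ?thesis
    using cmult_limit_le_at_right_0[OF \<delta>(1) _ tendsto_Hbar tendsto_Hbar] by blast
qed

lemma Pbar_amplified:
  assumes "\<nu> \<in> quasi_ahlfors_prob" "s < t"
  shows "ennreal c * Pbar \<mu> \<nu> q t E \<le> Pbar \<mu> \<nu> q s E"
proof -
  obtain \<delta> where \<delta>: "0 < \<delta>" "\<And>x r. 0 < r \<Longrightarrow> diameter (cball x r) < \<delta> \<Longrightarrow>
      ennreal c * ball_weight \<mu> \<nu> q t x r \<le> ball_weight \<mu> \<nu> q s x r"
    using ball_weight_amplified[OF assms] by metis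
  have "ennreal c * Pbar_eps \<mu> \<nu> q t \<epsilon> E \<le> Pbar_eps \<mu> \<nu> q s \<epsilon> E" if "\<epsilon> \<le> \<delta>" for \<epsilon>
    unfolding Pbar_eps_def[of _ _ _ t] SUP_mult_left_ennreal[where f = "\<lambda>y. y", unfolded image_ident]
  proof (rule SUP_least, clarify)
    fix I x r assume pack: "centred_packing \<epsilon> E I x r"
    then have "ennreal c * (\<Sum>\<^sub>\<infinity>i\<in>I. ball_weight \<mu> \<nu> q t (x i) (r i))
        \<le> (\<Sum>\<^sub>\<infinity>i\<in>I. ball_weight \<mu> \<nu> q s (x i) (r i))"
      using that unfolding centred_packing_def
      by (intro centred_sum_amplified[OF \<delta>(2)]) auto
    also have "\<dots> \<le> Pbar_eps \<mu> \<nu> q s \<epsilon> E"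
      using pack unfolding Pbar_eps_def by (intro Sup_upper) blast
    finally show "ennreal c * (\<Sum>\<^sub>\<infinity>i\<in>I. ball_weight \<mu> \<nu> q t (x i) (r i))
        \<le> Pbar_eps \<mu> \<nu> q s \<epsilon> E" .
  qed
  then show ?thesis
    using cmult_limit_le_at_right_0[OF \<delta>(1) _ tendsto_Pbar tendsto_Pbar] by blast
qed

lemma Hmeas_amplified:
  assumes "\<nu> \<in> quasi_ahlfors_prob" "s < t"
  shows "ennreal c * Hmeas \<mu> \<nu> q t E \<le> Hmeas \<mu> \<nu> q s E"
  unfolding Hmeas_def SUP_mult_left_ennreal
  using Hbar_amplified[OF assms] by (intro SUP_mono) blast

lemma Pmeas_amplified:
  assumes "\<nu> \<in> quasi_ahlfors_prob" "s < t"
  shows "ennreal c * Pmeas \<mu> \<nu> q t E \<le> Pmeas \<mu> \<nu> q s E"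
  unfolding Pmeas_def[of _ _ _ s]
proof (rule Inf_greatest, clarify)
  fix I :: "nat set" and S assume "E \<subseteq> (\<Union>i\<in>I. S i)"
  then have "Pmeas \<mu> \<nu> q t E \<le> (\<Sum>\<^sub>\<infinity>i\<in>I. Pbar \<mu> \<nu> q t (S i))"
    unfolding Pmeas_def by (intro Inf_lower) blast
  then have "ennreal c * Pmeas \<mu> \<nu> q t E \<le> ennreal c * (\<Sum>\<^sub>\<infinity>i\<in>I. Pbar \<mu> \<nu> q t (S i))"
    by (rule mult_left_mono) simp
  also have "\<dots> \<le> (\<Sum>\<^sub>\<infinity>i\<in>I. Pbar \<mu> \<nu> q s (S i))"
    by (intro cmult_infsum_le_ennreal Pbar_amplified assms)
  finally show "ennreal c * Pmeas \<mu> \<nu> q t E \<le> (\<Sum>\<^sub>\<infinity>i\<in>I. Pbar \<mu> \<nu> q s (S i))" .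
qed

theorem proposition3p1:
  fixes \<mu> :: "'k::finite \<Rightarrow> (real^'d) measure"
    and \<nu> :: "(real^'d) measure"
    and q :: "real^'k"
    and E :: "(real^'d) set"
  assumes "\<And>j. \<mu> j \<in> borel_prob"
    and "\<nu> \<in> quasi_ahlfors_prob"
  shows "(\<exists>!dim::ereal. \<forall>t::real.
            (ereal t < dim \<longrightarrow> Hmeas \<mu> \<nu> q t E = \<infinity>) \<and>
            (dim < ereal t \<longrightarrow> Hmeas \<mu> \<nu> q t E = 0)) \<and>
         (\<exists>!\<Delta>::ereal. \<forall>t::real.
            (ereal t < \<Delta> \<longrightarrow> Pbar \<mu> \<nu> q t E = \<infinity>) \<and>
            (\<Delta> < ereal t \<longrightarrow> Pbar \<mu> \<nu> q t E = 0)) \<and>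
         (\<exists>!Dim::ereal. \<forall>t::real.
            (ereal t < Dim \<longrightarrow> Pmeas \<mu> \<nu> q t E = \<infinity>) \<and>
            (Dim < ereal t \<longrightarrow> Pmeas \<mu> \<nu> q t E = 0))"
  by (intro conjI critical_exponent Hmeas_amplified Pbar_amplified Pmeas_amplified assms(2))

end
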